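(* Let $r,s\in\mathbb{N}$ with $s\le r$ and let $1\le p<\infty$. There is a constant $C>0$, independent of $f$ and $W$, such that for every $f\in\Lambda^p$ and every $W>0$ $$\tilde\Omega_{r,s}\left(f,\tfrac1W,\Sigma_W\right)_p\le C\,\tau_s(f,1/W)_p.$$
   Context: Conventions: $\mathbb{N}=\{1,2,\dots\}$; functions are defined pointwise (functions equal almost everywhere are not identified); $\|\cdot\|_p$ is the $L^p(\mathbb{R})$ norm. $M(\mathbb{R})$ is the set of bounded measurable functions on $\mathbb{R}$. A sequence $\Sigma=(x_j)_{j\in\mathbb{Z}}\subset\mathbb{R}$ is admissible if $0<\inf_j(x_j-x_{j-1})\le\sup_j(x_j-x_{j-1})<\infty$; put $\|f\|_{\ell_p(\Sigma)}=\big(\sum_{j\in\mathbb{Z}}|f(x_j)|^p(x_j-x_{j-1})\big)^{1/p}$. $\Lambda^p=\{f\in M(\mathbb{R}):\|f\|_{\ell_p(\Sigma)}<\infty\text{ for every admissible }\Sigma\}\subset L^p(\mathbb{R})$. $\Sigma_W=(j/W)_{j\in\mathbb{Z}}$, so $\|f\|_{\ell_p(\Sigma_W)}=\big(\frac1W\sum_{j\in\mathbb{Z}}|f(j/W)|^p\big)^{1/p}$. Modulus of smoothness: $\Delta_h^s f(x)=\sum_{k=0}^s\binom sk(-1)^{s-k}f(x+kh)$, $\omega_s(f,\delta)_p=\sup_{0<h\le\delta}\|\Delta_h^sf\|_p$. Local and averaged moduli for $f\in M(\mathbb{R})$: $\omega_s(f,x;\delta)=\sup\{|\Delta_h^sf(t)|:\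 t,\,t+sh\in[x-\frac{s\delta}2,x+\frac{s\delta}2]\}$ and $\tau_s(f,\delta)_p=\|\omega_s(f,\cdot;\delta)\|_p$, $\delta>0$ (finite for $f\in\Lambda^p$). Steklov averages ($\delta>0$): $\tilde f_{\delta,r}(x)=(-\delta)^{-r}\int_0^\delta\cdots\int_0^\delta\sum_{m=1}^r(-1)^{r-m+1}\binom rm f\big(x+\frac mr(t_1+\dots+t_r)\big)\,dt_1\cdots dt_r$. Semi-discrete modulus: $\tilde\Omega_{r,s}(f,\frac1W,\Sigma_W)_p=\|\tilde f_{1/W,r}-f\|_{\ell_p(\Sigma_W)}+\omega_s(f,1/W)_p$. *)

theory Defs
  imports "HOL-Analysis.Analysis"
begin

text \<open>Functions are genuine pointwise functions \<open>real \<Rightarrow> complex\<close>, and measurable means Lebesgue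
  measurable.  All norms and moduli built from norms take values in \<^typ>\<open>ennreal\<close>, so that
  a divergent sum or integral is \<open>\<infinity>\<close>.\<close>

definition ennreal_power :: "ennreal \<Rightarrow> real \<Rightarrow> ennreal" where
  "ennreal_power x a = (if x = \<infinity> then \<infinity> else ennreal (enn2real x powr a))"
  \<comment> \<open>only meant for exponents \<open>a > 0\<close>\<close>

definition Lp_norm :: "real \<Rightarrow> (real \<Rightarrow> 'a::real_normed_vector) \<Rightarrow> ennreal" where
  "Lp_norm p f = ennreal_power (\<integral>\<^sup>+ x. ennreal (norm (f x) powr p) \<partial>lebesgue) (1 / p)"

definition bounded_measurable :: "(real \<Rightarrow> complex) set" where
  "bounded_measurable = {f. f \<in> borel_measurable lebesgue \<and> bounded (range f)}"

text \<open>The infimum and supremum are taken in the extended reals, since on \<^typ>\<open>real\<close> they are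
  unspecified for unbounded sets.\<close>

definition admissible :: "(int \<Rightarrow> real) \<Rightarrow> bool" where
  "admissible \<Sigma> \<longleftrightarrow>
     0 < (INF j. ereal (\<Sigma> j - \<Sigma> (j - 1))) \<and> (SUP j. ereal (\<Sigma> j - \<Sigma> (j - 1))) < \<infinity>"

definition lp_norm :: "real \<Rightarrow> (int \<Rightarrow> real) \<Rightarrow> (real \<Rightarrow> complex) \<Rightarrow> ennreal" where
  "lp_norm p \<Sigma> f =
     ennreal_power (\<Sum>\<^sub>\<infinity>j. ennreal (cmod (f (\<Sigma> j)) powr p * (\<Sigma> j - \<Sigma> (j - 1)))) (1 / p)"

definition Lambda_space :: "real \<Rightarrow> (real \<Rightarrow> complex) set" where
  "Lambda_space p = {f \<in> bounded_measurable. \<forall>\<Sigma>. admissible \<Sigma> \<longrightarrow> lp_norm p \<Sigma> f < \<infinity>}"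

definition uniform_nodes :: "real \<Rightarrow> int \<Rightarrow> real" where
  "uniform_nodes W j = of_int j / W"

definition fin_diff :: "nat \<Rightarrow> real \<Rightarrow> (real \<Rightarrow> complex) \<Rightarrow> real \<Rightarrow> complex" where
  "fin_diff s h f x = (\<Sum>k=0..s. of_nat (s choose k) * (-1) ^ (s - k) * f (x + of_nat k * h))"

definition smoothness_modulus :: "nat \<Rightarrow> real \<Rightarrow> (real \<Rightarrow> complex) \<Rightarrow> real \<Rightarrow> ennreal" where
  "smoothness_modulus s p f \<delta> = (SUP h\<in>{0<..\<delta>}. Lp_norm p (fin_diff s h f))"

text \<open>The set below is nonempty for \<open>\<delta> > 0\<close> and bounded for bounded \<open>f\<close>, so the supremum may be
  taken in \<^typ>\<open>real\<close>.\<close>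

definition local_modulus :: "nat \<Rightarrow> (real \<Rightarrow> complex) \<Rightarrow> real \<Rightarrow> real \<Rightarrow> real" where
  "local_modulus s f x \<delta> =
     Sup {cmod (fin_diff s h f t) | t h.
            t \<in> {x - of_nat s * \<delta> / 2 .. x + of_nat s * \<delta> / 2} \<and>
            t + of_nat s * h \<in> {x - of_nat s * \<delta> / 2 .. x + of_nat s * \<delta> / 2}}"

definition averaged_modulus :: "nat \<Rightarrow> real \<Rightarrow> (real \<Rightarrow> complex) \<Rightarrow> real \<Rightarrow> ennreal" where
  "averaged_modulus s p f \<delta> = Lp_norm p (\<lambda>x. local_modulus s f x \<delta>)"

text \<open>\<open>iterated_integral \<delta> n g\<close> is the \<open>n\<close>-fold iterated integral over \<open>[0, \<delta>]\<close> of \<open>g [t\<^sub>1, \<dots>, t\<^sub>n]\<close>.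
  An integral over a product measure space would be unsuitable: for \<open>f\<close> Lebesgue
  measurable, \<open>f (t\<^sub>1 + \<dots> + t\<^sub>n)\<close> need not be measurable for the uncompleted product
  sigma-algebra.\<close>

primrec iterated_integral :: "real \<Rightarrow> nat \<Rightarrow> (real list \<Rightarrow> complex) \<Rightarrow> complex" where
  "iterated_integral \<delta> 0 g = g []"
| "iterated_integral \<delta> (Suc n) g =
     set_lebesgue_integral lebesgue {0..\<delta>} (\<lambda>t. iterated_integral \<delta> n (\<lambda>ts. g (t # ts)))"

definition steklov :: "real \<Rightarrow> nat \<Rightarrow> (real \<Rightarrow> complex) \<Rightarrow> real \<Rightarrow> complex" where
  "steklov \<delta> r f x =
     of_real ((- \<delta>) powi (- int r)) *
     iterated_integral \<delta> r
       (\<lambda>ts. \<Sum>m=1..r. (-1) ^ (r - m + 1) * of_nat (r choose m) *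
                        f (x + of_nat m / of_nat r * sum_list ts))"

definition semi_discrete_modulus ::
    "nat \<Rightarrow> nat \<Rightarrow> real \<Rightarrow> (real \<Rightarrow> complex) \<Rightarrow> real \<Rightarrow> (int \<Rightarrow> real) \<Rightarrow> ennreal" where
  "semi_discrete_modulus r s p f \<delta> \<Sigma> =
     lp_norm p \<Sigma> (\<lambda>x. steklov \<delta> r f x - f x) + smoothness_modulus s p f \<delta>"

end

theory Submission
  imports Defs
begin

text \<open>Write \<open>d = 1 / W\<close>.  The modulus of smoothness is the easy part: \<open>\<bar>\<Delta>\<^sub>h\<^sup>s f x\<bar>\<close> with \<open>h \<le> d\<close> is at most the
  local modulus at the midpoint \<open>x + s h / 2\<close>, and the \<open>L\<^sup>p\<close> norm is translation invariant
  (\<open>smoothness_modulus_le_averaged_modulus\<close>).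

  For the discrete part, the Steklov average minus \<open>f x\<close> is, up to sign, a mean of the differences
  \<open>\<Delta>\<^sub>h\<^sup>r f x\<close> with \<open>0 \<le> h \<le> d\<close> (\<open>steklov_minus_bound\<close>).  Such a difference of order \<open>r\<close> and step
  \<open>h\<close> is a combination of differences of order \<open>s\<close> and step \<open>h / 2\<close> at points of \<open>[x, x + r d]\<close>.
  Because of the halved step, each of them has its nodes in the window not of one point only but of all
  points near its midpoint.  So whatever \<open>u \<in> [0, d]\<close> is, \<open>\<bar>\<Delta>\<^sub>h\<^sup>r f x\<bar>\<close> is bounded, up to a constant,
  by the sum of the local moduli at the boundedly many points \<open>x + u + l d / 4\<close>
  (\<open>fin_diff_le_sum_open_local_modulus\<close>).  Taking \<open>p\<close>-th powers, integrating over \<open>u\<close>, and summing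
  over the nodes \<open>x = j d\<close> glues the intervals \<open>[j d, (j + 1) d)\<close> together to the line and gives
  the \<open>p\<close>-th power of the averaged modulus (\<open>sampled_power_sum_le\<close>).

  The lower bound for the averaged modulus is obtained through a Borel measurable minorant of
  the local modulus, the same supremum over open windows.\<close>

section \<open>Finite differences\<close>

text \<open>Iterating \<open>\<Delta>\<^sub>h\<^sup>1\<close> gives \<open>\<Delta>\<^sub>h\<^sup>s\<close>; the estimates for differences
  are inductions along this recursion, which is Pascal's rule.\<close>

lemma fin_diff_Suc:
  "fin_diff (Suc s) h f x = fin_diff s h (\<lambda>y. f (y + h) - f y) x"
proof -
  define a where "a k = (-1) ^ (s - k) * f (x + of_nat k * h)" for k
  have sgn: "(-1::complex) ^ (Suc s - k) = - ((-1) ^ (s - k))" if "k \<le> s" for k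
    using that by (simp add: Suc_diff_le)
  have "fin_diff (Suc s) h f x =
     (-1) ^ Suc s * f x + (\<Sum>k\<le>s. of_nat (Suc s choose Suc k) * (-1) ^ (s - k) * f (x + of_nat (Suc k) * h))"
    unfolding fin_diff_def atLeast0AtMost by (subst sum.atMost_Suc_shift) simp
  also have "(\<Sum>k\<le>s. of_nat (Suc s choose Suc k) * (-1) ^ (s - k) * f (x + of_nat (Suc k) * h))
    = (\<Sum>k\<le>s. of_nat (s choose k) * (-1) ^ (s - k) * f (x + of_nat (Suc k) * h))
      + (\<Sum>k\<le>s. of_nat (s choose Suc k) * (-1) ^ (s - k) * f (x + of_nat (Suc k) * h))"
    by (simp add: algebra_simps flip: sum.distrib)
  also have "(-1) ^ Suc s * f x + (\<dots>) =
     (\<Sum>k\<le>s. of_nat (s choose k) * (-1) ^ (s - k) * f (x + of_nat (Suc k) * h))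
     + ((-1) ^ Suc s * f x + (\<Sum>k\<le>s. of_nat (s choose Suc k) * (-1) ^ (s - k) * f (x + of_nat (Suc k) * h)))"
    by simp
  also have "(-1) ^ Suc s * f x + (\<Sum>k\<le>s. of_nat (s choose Suc k) * (-1) ^ (s - k) * f (x + of_nat (Suc k) * h))
     = (\<Sum>k\<le>Suc s. of_nat (s choose k) * (-1) ^ (Suc s - k) * f (x + of_nat k * h))"
    by (subst sum.atMost_Suc_shift) simp
  also have "\<dots> = (\<Sum>k\<le>s. - (of_nat (s choose k) * (-1) ^ (s - k) * f (x + of_nat k * h)))"
    by (simp add: sgn binomial_eq_0)
  finally show ?thesis
    unfolding fin_diff_def atLeast0AtMost
    by (simp add: sum_negf sum_subtractf algebra_simps)
qed

lemma fin_diff_add: "fin_diff s h (\<lambda>y. f y + g y) x = fin_diff s h f x + fin_diff s h g x"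
  by (simp add: fin_diff_def algebra_simps sum.distrib)

lemma fin_diff_diff: "fin_diff s h (\<lambda>y. f y - g y) x = fin_diff s h f x - fin_diff s h g x"
  by (simp add: fin_diff_def algebra_simps sum_subtractf)

lemma fin_diff_shift: "fin_diff s h (\<lambda>y. f (y + c)) x = fin_diff s h f (x + c)"
  by (simp add: fin_diff_def algebra_simps)

text \<open>With \<open>T\<close> the translation by \<open>h\<close>, this is the factorization
  \<open>(T\<^sup>2 - 1)\<^sup>s = (T + 1)\<^sup>s (T - 1)\<^sup>s\<close>: a difference of step \<open>2h\<close> is a combination, with
  coefficients of sum \<open>2\<^sup>s\<close>, of differences of step \<open>h\<close> at the points \<open>x + k h\<close>.\<close>

lemma fin_diff_double_step_bound:
  assumes "\<And>k. k \<le> s \<Longrightarrow> cmod (fin_diff s h f (x + of_nat k * h)) \<le> M"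
  shows "cmod (fin_diff s (2 * h) f x) \<le> 2 ^ s * M"
  using assms
proof (induction s arbitrary: f x)
  case 0
  then show ?case by (simp add: fin_diff_def)
next
  case (Suc s)
  define g where "g = (\<lambda>y. f (y + h) - f y)"
  have g: "fin_diff s h g y = fin_diff (Suc s) h f y" for y
    by (simp add: fin_diff_Suc g_def)
  have "(\<lambda>y. f (y + 2 * h) - f y) = (\<lambda>y. g (y + h) + g y)"
    by (simp add: g_def add.assoc)
  then have eq: "fin_diff (Suc s) (2 * h) f x = fin_diff s (2 * h) g (x + h) + fin_diff s (2 * h) g x"
    by (simp add: fin_diff_Suc fin_diff_add fin_diff_shift)
  have "cmod (fin_diff s (2 * h) g (x + h)) \<le> 2 ^ s * M"
  proof (rule Suc.IH)
    fix k assume "k \<le> s"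
    then show "cmod (fin_diff s h g (x + h + of_nat k * h)) \<le> M"
      using Suc.prems[of "Suc k"] by (simp add: g algebra_simps)
  qed
  moreover have "cmod (fin_diff s (2 * h) g x) \<le> 2 ^ s * M"
    by (rule Suc.IH) (use Suc.prems in \<open>auto simp: g\<close>)
  ultimately show ?case
    unfolding eq by (intro order_trans[OF norm_triangle_ineq]) simp
qed

text \<open>The factorization \<open>(T - 1)\<^sup>m\<^sup>+\<^sup>s = (T - 1)\<^sup>m (T - 1)\<^sup>s\<close>.\<close>

lemma fin_diff_raise_order_bound:
  assumes "\<And>i. i \<le> m \<Longrightarrow> cmod (fin_diff s h f (x + of_nat i * h)) \<le> M"
  shows "cmod (fin_diff (m + s) h f x) \<le> 2 ^ m * M"
  using assms
proof (induction m arbitrary: x)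
  case 0
  then show ?case using "0"[of 0] by simp
next
  case (Suc m)
  have eq: "fin_diff (Suc m + s) h f x = fin_diff (m + s) h f (x + h) - fin_diff (m + s) h f x"
    by (simp add: fin_diff_Suc fin_diff_diff fin_diff_shift)
  have "cmod (fin_diff (m + s) h f (x + h)) \<le> 2 ^ m * M"
  proof (rule Suc.IH)
    fix k assume "k \<le> m"
    then show "cmod (fin_diff s h f (x + h + of_nat k * h)) \<le> M"
      using Suc.prems[of "Suc k"] by (simp add: algebra_simps)
  qed
  moreover have "cmod (fin_diff (m + s) h f x) \<le> 2 ^ m * M"
    by (rule Suc.IH) (use Suc.prems in auto)
  ultimately show ?case
    unfolding eq by (intro order_trans[OF norm_triangle_ineq4]) simp
qed

lemma fin_diff_bound:
  assumes "\<And>y. cmod (f y) \<le> B"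
  shows "cmod (fin_diff s h f x) \<le> 2 ^ s * B"
  using fin_diff_raise_order_bound[of s 0 h f x B] assms by (simp add: fin_diff_def)

section \<open>Iterated integrals of bounded measurable functions\<close>

lemma measurable_lebesgue_translation: "(\<lambda>x. x + c) \<in> lebesgue \<rightarrow>\<^sub>M (lebesgue :: real measure)"
  using lebesgue_affine_measurable[where c = "\<lambda>x::real. 1" and t = c] by (simp add: add.commute)

lemma nn_integral_lebesgue_translation:
  fixes g :: "real \<Rightarrow> ennreal"
  assumes "g \<in> borel_measurable lebesgue"
  shows "(\<integral>\<^sup>+x. g (x + c) \<partial>lebesgue) = (\<integral>\<^sup>+x. g x \<partial>lebesgue)"
  using nn_integral_real_affine_lebesgue[OF assms, of 1 c] by (simp add: add.commute)

lemma integrable_lebesgue_interval: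
  fixes G :: "real \<Rightarrow> complex"
  assumes "G \<in> borel_measurable lebesgue" and "\<And>u. cmod (G u) \<le> B"
  shows "set_integrable lebesgue {a..b} G"
  unfolding set_integrable_def
  by (rule integrableI_bounded_set_indicator[where B = B]) (use assms in \<open>auto simp: emeasure_lborel_Icc_eq\<close>)

text \<open>A window integral of a bounded function depends continuously on the window.  This keeps the
  inner integrals of an iterated integral measurable, although \<open>(c, t) \<mapsto> G (c + t)\<close> may fail to
  be measurable for the product of the two Lebesgue sigma-algebras.\<close>

lemma moving_integral_measurable:
  fixes G :: "real \<Rightarrow> complex"
  assumes G: "G \<in> borel_measurable lebesgue" "\<And>u. cmod (G u) \<le> B" and "0 \<le> d"
  shows "(\<lambda>c. LINT t:{0..d}|lebesgue. G (c + t)) \<in> borel_measurable lebesgue"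
proof -
  note int = integrable_lebesgue_interval[OF G]
  have eq: "(LINT t:{0..d}|lebesgue. G (c + t)) = integral {c..c+d} G" for c
  proof -
    have "integral {c..c+d} G = (LINT u:{c..c+d}|lebesgue. G u)"
      by (rule set_lebesgue_integral_eq_integral(2)[symmetric, OF int])
    also have "\<dots> = (LINT t:{0..d}|lebesgue. G (c + t))"
      unfolding set_lebesgue_integral_def
      by (subst lebesgue_integral_real_affine[where c = 1 and t = c])
         (auto intro!: Bochner_Integration.integral_cong simp: indicator_def)
    finally show ?thesis ..
  qed
  have "isCont (\<lambda>c. integral {c..c+d} G) c\<^sub>0" for c\<^sub>0
  proof -
    \<comment> \<open>an antiderivative near \<open>c\<^sub>0\<close>; no base point serves all of the line at once\<close>
    let ?F = "\<lambda>x. integral {c\<^sub>0 - 1..x} G"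
    have "continuous_on {c\<^sub>0 - 1..c\<^sub>0 + 1 + d} ?F"
      by (rule indefinite_integral_continuous_1)
         (rule set_lebesgue_integral_eq_integral(1)[OF int])
    then have F: "continuous_on {c\<^sub>0 - 1..c\<^sub>0 + 1} ?F"
      and F': "continuous_on ((\<lambda>c. c + d) ` {c\<^sub>0 - 1..c\<^sub>0 + 1}) ?F"
      by (rule continuous_on_subset; use \<open>0 \<le> d\<close> in auto)+
    have "continuous_on {c\<^sub>0 - 1..c\<^sub>0 + 1} (\<lambda>c. ?F (c + d))"
      using continuous_on_compose[OF _ F'] by (simp add: o_def continuous_on_add)
    with F have "continuous_on {c\<^sub>0 - 1..c\<^sub>0 + 1} (\<lambda>c. ?F (c + d) - ?F c)"
      by (intro continuous_on_diff)
    moreover have "?F (c + d) - ?F c = integral {c..c+d} G" if "c \<in> {c\<^sub>0 - 1..c\<^sub>0 + 1}" for c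
      using Henstock_Kurzweil_Integration.integral_combine[of "c\<^sub>0 - 1" c "c + d" G] that \<open>0 \<le> d\<close>
        set_lebesgue_integral_eq_integral(1)[OF int, of "c\<^sub>0 - 1" "c + d"]
      by (auto simp: algebra_simps)
    ultimately have "continuous_on {c\<^sub>0 - 1..c\<^sub>0 + 1} (\<lambda>c. integral {c..c+d} G)"
      by (rule continuous_on_eq)
    then have "continuous_on {c\<^sub>0 - 1<..<c\<^sub>0 + 1} (\<lambda>c. integral {c..c+d} G)"
      by (rule continuous_on_subset) auto
    then show ?thesis
      by (simp add: continuous_on_eq_continuous_at)
  qed
  then have "(\<lambda>c. integral {c..c+d} G) \<in> borel_measurable borel"
    by (intro borel_measurable_continuous_onI continuous_at_imp_continuous_on) auto
  then show ?thesis
    unfolding eq by (intro measurable_completion) simp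
qed

lemma interval_integral_close_to_constant:
  fixes G :: "real \<Rightarrow> complex"
  assumes G: "G \<in> borel_measurable lebesgue" "\<And>u. cmod (G u) \<le> B"
    and "a \<le> b" and close: "\<And>u. u \<in> {a..b} \<Longrightarrow> cmod (G u - K) \<le> M"
  shows "cmod ((LINT u:{a..b}|lebesgue. G u) - of_real (b - a) * K) \<le> (b - a) * M"
proof -
  have M: "0 \<le> M"
    using order_trans[OF norm_ge_zero close[of a]] \<open>a \<le> b\<close> by simp
  note int = set_lebesgue_integral_eq_integral[OF integrable_lebesgue_interval[OF G]]
  have const: "((\<lambda>u. K) has_integral (b - a) *\<^sub>R K) {a..b}"
    using has_integral_const_real[of K a b] \<open>a \<le> b\<close> by simp
  have "((\<lambda>u. G u - K) has_integral (integral {a..b} G - (b - a) *\<^sub>R K)) {a..b}"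
    by (intro has_integral_diff integrable_integral int(1) const)
  from has_integral_bound_real[OF M finite.emptyI this] close
  show ?thesis
    using \<open>a \<le> b\<close> by (simp add: int(2) scaleR_conv_of_real mult.commute)
qed

text \<open>Averaging over the cube \<open>[0, d]\<^sup>n\<close> preserves the distance \<open>M\<close> from a constant \<open>K\<close>.
  The point \<open>c\<close> has to vary because the first integration turns \<open>H (c + t + \<dots>)\<close> into the
  same problem with \<open>c + t\<close> in place of \<open>c\<close>; measurability and boundedness in \<open>c\<close> are carried
  along since an integral that fails to exist is \<open>0\<close> and would spoil the estimate.\<close>

lemma iterated_integral_close_to_constant:
  fixes H :: "real \<Rightarrow> complex"
  assumes H: "H \<in> borel_measurable lebesgue" "\<And>u. cmod (H u) \<le> B" and "0 \<le> d"
  defines "J \<equiv> \<lambda>n c. iterated_integral d n (\<lambda>ts. H (c + sum_list ts))"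
  shows "J n \<in> borel_measurable lebesgue \<and> (\<forall>c. cmod (J n c) \<le> d ^ n * B) \<and>
    (\<forall>c. (\<forall>u\<in>{c..c + of_nat n * d}. cmod (H u - K) \<le> M) \<longrightarrow>
       cmod (J n c - of_real (d ^ n) * K) \<le> d ^ n * M)"
proof (induction n)
  case 0
  then show ?case using H by (simp add: J_def)
next
  case (Suc n)
  then have G: "J n \<in> borel_measurable lebesgue" "\<And>c. cmod (J n c) \<le> d ^ n * B" by auto
  have rec: "J (Suc n) c = (LINT t:{0..d}|lebesgue. J n (c + t))" for c
    by (simp add: J_def add.assoc)
  have meas: "(\<lambda>t. J n (c + t)) \<in> borel_measurable lebesgue" for c
    using measurable_compose[OF measurable_lebesgue_translation[of c] G(1)] by (simp add: add.commute)
  have close: "cmod (J (Suc n) c - of_real d * K') \<le> d * M'"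
    if "\<And>t. t \<in> {0..d} \<Longrightarrow> cmod (J n (c + t) - K') \<le> M'" for c K' M'
    using interval_integral_close_to_constant[OF meas G(2) \<open>0 \<le> d\<close> that] by (simp add: rec)
  have "cmod (J (Suc n) c) \<le> d ^ Suc n * B" for c
    using close[of c 0 "d ^ n * B"] G(2) by (simp add: mult.assoc)
  moreover have "cmod (J (Suc n) c - of_real (d ^ Suc n) * K) \<le> d ^ Suc n * M"
    if *: "\<forall>u\<in>{c..c + of_nat (Suc n) * d}. cmod (H u - K) \<le> M" for c
  proof -
    have "cmod (J n (c + t) - of_real (d ^ n) * K) \<le> d ^ n * M" if t: "t \<in> {0..d}" for t
    proof -
      have "\<forall>u\<in>{c + t..c + t + of_nat n * d}. cmod (H u - K) \<le> M"
        using t * by (auto simp: algebra_simps)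
      with Suc show ?thesis by blast
    qed
    from close[OF this] show ?thesis by (simp add: mult.assoc)
  qed
  moreover have "J (Suc n) \<in> borel_measurable lebesgue"
    using moving_integral_measurable[OF G \<open>0 \<le> d\<close>] by (simp add: rec[abs_def])
  ultimately show ?case by blast
qed

section \<open>Steklov averages\<close>

lemma lebesgue_measurable_compose_affine:
  fixes f :: "real \<Rightarrow> complex"
  assumes "f \<in> borel_measurable lebesgue" and "c \<noteq> 0"
  shows "(\<lambda>u. f (x + c * u)) \<in> borel_measurable lebesgue"
  using measurable_compose[OF lebesgue_affine_measurable[where c = "\<lambda>_::real. c" and t = x] assms(1)] assms(2)
  by simp

text \<open>The sum in the Steklov average lacks only the term \<open>m = 0\<close> of \<open>- \<Delta>\<^sub>h\<^sup>r f x\<close> with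
  \<open>h = (t\<^sub>1 + \<dots> + t\<^sub>r) / r\<close>, and the normalization makes that missing term exactly \<open>f x\<close>.  So
  the Steklov average minus \<open>f x\<close> is, up to sign, the mean of \<open>\<Delta>\<^sub>h\<^sup>r f x\<close> with \<open>h \<in> [0, d]\<close>.\<close>

lemma steklov_minus_bound:
  assumes f: "f \<in> borel_measurable lebesgue" "\<And>y. cmod (f y) \<le> B" and "0 < d" "1 \<le> r"
    and M: "\<And>h. h \<in> {0..d} \<Longrightarrow> cmod (fin_diff r h f x) \<le> M"
  shows "cmod (steklov d r f x - f x) \<le> M"
proof -
  define H where "H u = (\<Sum>m=1..r. (-1) ^ (r - m + 1) * of_nat (r choose m) * f (x + of_nat m / of_nat r * u))"
    for u
  define K where "K = (-1) ^ r * f x"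
  define J where "J = iterated_integral d r (\<lambda>ts. H (0 + sum_list ts))"
  have H_diff: "H u - K = - fin_diff r (u / of_nat r) f x" for u
    unfolding fin_diff_def H_def K_def
    by (subst sum.atLeast_Suc_atMost) (auto simp: sum_negf[symmetric] algebra_simps intro!: sum.cong)
  have "H \<in> borel_measurable lebesgue"
    unfolding H_def[abs_def]
    by (intro borel_measurable_sum borel_measurable_times borel_measurable_const
        lebesgue_measurable_compose_affine f) (use \<open>1 \<le> r\<close> in auto)
  moreover have "cmod (H u) \<le> 2 ^ r * B + cmod K" for u
    using norm_triangle_ineq2[of "H u" K] fin_diff_bound[of f B r "u / of_nat r" x, OF f(2)]
    by (simp add: H_diff)
  moreover have "cmod (H u - K) \<le> M" if "u \<in> {0..0 + of_nat r * d}" for u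
    using that M[of "u / of_nat r"] \<open>1 \<le> r\<close> by (simp add: H_diff divide_simps mult.commute)
  ultimately have J: "cmod (J - of_real (d ^ r) * K) \<le> d ^ r * M"
    unfolding J_def using iterated_integral_close_to_constant[where H = H and B = "2 ^ r * B + cmod K" and d = d and n = r and K = K and M = M] \<open>0 < d\<close>
    by (auto simp del: add_0_left)
  define c where "c = (- d) powi (- int r)"
  have c: "c = inverse ((- d) ^ r)"
    by (simp add: c_def power_int_minus)
  have "complex_of_real c * of_real (d ^ r) * K = f x"
  proof -
    have "c * d ^ r * (-1) ^ r = 1"
      using \<open>0 < d\<close> by (simp add: c power_minus[of d] field_simps)
    then have "complex_of_real (c * d ^ r * (-1) ^ r) = 1" by simp
    then show ?thesis by (simp add: K_def mult.assoc[symmetric])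
  qed
  then have "steklov d r f x - f x = of_real c * (J - of_real (d ^ r) * K)"
    by (simp add: steklov_def J_def H_def c_def right_diff_distrib mult.assoc[symmetric])
  then have "cmod (steklov d r f x - f x) \<le> \<bar>c\<bar> * (d ^ r * M)"
    using J by (simp add: norm_mult mult_left_mono del: of_real_power)
  also have "\<bar>c\<bar> * (d ^ r * M) = M"
    using \<open>0 < d\<close> by (simp add: c power_abs)
  finally show ?thesis .
qed

section \<open>The local modulus\<close>

text \<open>With an open instead of a closed window the local modulus is lower semicontinuous in \<open>x\<close>,
  hence a Borel function.  It is a measurable minorant of \<^const>\<open>local_modulus\<close>, so that
  integrals of the latter need only be bounded from below by monotonicity.\<close>

definition open_local_modulus :: "nat \<Rightarrow> (real \<Rightarrow> complex) \<Rightarrow> real \<Rightarrow> real \<Rightarrow> real" where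
  "open_local_modulus s f d x =
     Sup {cmod (fin_diff s h f t) | t h.
            \<bar>t - x\<bar> < of_nat s * d / 2 \<and> \<bar>t + of_nat s * h - x\<bar> < of_nat s * d / 2}"

lemma local_modulus_upper:
  assumes "\<And>y. cmod (f y) \<le> B"
    and "\<bar>t - x\<bar> \<le> of_nat s * d / 2" and "\<bar>t + of_nat s * h - x\<bar> \<le> of_nat s * d / 2"
  shows "cmod (fin_diff s h f t) \<le> local_modulus s f x d"
  unfolding local_modulus_def
proof (rule cSup_upper)
  show "bdd_above {cmod (fin_diff s h f t) | t h.
            t \<in> {x - of_nat s * d / 2 .. x + of_nat s * d / 2} \<and>
            t + of_nat s * h \<in> {x - of_nat s * d / 2 .. x + of_nat s * d / 2}}"
    using fin_diff_bound[OF assms(1)] by (intro bdd_aboveI[of _ "2 ^ s * B"]) auto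
  show "cmod (fin_diff s h f t) \<in> {cmod (fin_diff s h f t) | t h.
            t \<in> {x - of_nat s * d / 2 .. x + of_nat s * d / 2} \<and>
            t + of_nat s * h \<in> {x - of_nat s * d / 2 .. x + of_nat s * d / 2}}"
    unfolding mem_Collect_eq
    by (rule exI[of _ t], rule exI[of _ h]) (use assms(2,3) in \<open>unfold atLeastAtMost_iff abs_le_iff, linarith\<close>)
qed

context
  fixes f :: "real \<Rightarrow> complex" and B d :: real and s :: nat
  assumes bound: "\<And>y. cmod (f y) \<le> B" and d: "0 < d" and s: "1 \<le> s"
begin

lemma open_local_modulus_less_iff:
  "c < open_local_modulus s f d x \<longleftrightarrow>
    (\<exists>t h. \<bar>t - x\<bar> < of_nat s * d / 2 \<and> \<bar>t + of_nat s * h - x\<bar> < of_nat s * d / 2 \<and>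
           c < cmod (fin_diff s h f t))"
proof -
  let ?S = "{cmod (fin_diff s h f t) | t h.
            \<bar>t - x\<bar> < of_nat s * d / 2 \<and> \<bar>t + of_nat s * h - x\<bar> < of_nat s * d / 2}"
  have "bdd_above ?S"
    using fin_diff_bound[OF bound] by (intro bdd_aboveI[of _ "2 ^ s * B"]) auto
  moreover have "cmod (fin_diff s 0 f x) \<in> ?S"
    using d s by (intro CollectI exI[of _ x] exI[of _ 0]) auto
  ultimately show ?thesis
    unfolding open_local_modulus_def by (subst less_cSup_iff) auto
qed

lemma open_local_modulus_upper:
  assumes "\<bar>t - x\<bar> < of_nat s * d / 2" and "\<bar>t + of_nat s * h - x\<bar> < of_nat s * d / 2"
  shows "cmod (fin_diff s h f t) \<le> open_local_modulus s f d x"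
  using open_local_modulus_less_iff[of "open_local_modulus s f d x" x] assms by force

lemma open_local_modulus_nonneg: "0 \<le> open_local_modulus s f d x"
  using order_trans[OF norm_ge_zero open_local_modulus_upper[of x x 0]] d s by simp

lemma open_local_modulus_le: "open_local_modulus s f d x \<le> local_modulus s f x d"
proof (rule ccontr)
  assume "\<not> ?thesis"
  then obtain t h where "\<bar>t - x\<bar> < of_nat s * d / 2" "\<bar>t + of_nat s * h - x\<bar> < of_nat s * d / 2"
    and "local_modulus s f x d < cmod (fin_diff s h f t)"
    by (auto simp: not_le open_local_modulus_less_iff)
  with local_modulus_upper[of f B t x s d h] bound show False by auto
qed

text \<open>A point \<open>x\<close> at which the modulus exceeds \<open>c\<close> has a witness \<open>(t, h)\<close>, and the same witness
  serves all points close to \<open>x\<close>.\<close>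

lemma open_local_modulus_measurable: "open_local_modulus s f d \<in> borel_measurable borel"
proof (rule borel_measurableI_greater)
  fix c
  have "{x \<in> space borel. c < open_local_modulus s f d x} =
    (\<Union>(t, h) \<in> {(t, h). c < cmod (fin_diff s h f t)}.
       {x. \<bar>t - x\<bar> < of_nat s * d / 2 \<and> \<bar>t + of_nat s * h - x\<bar> < of_nat s * d / 2})"
    by (auto simp: open_local_modulus_less_iff)
  also have "open \<dots>"
    by (intro open_UN ballI) (auto intro!: open_Collect_conj open_Collect_less continuous_intros)
  finally show "{x \<in> space borel. c < open_local_modulus s f d x} \<in> sets borel"
    by (rule borel_open)
qed

text \<open>A bound that holds for all shifts \<open>u\<close> of the grid of centres is what allows averaging over
  \<open>u\<close> later on.  A difference of order \<open>s\<close> and step \<open>d\<close> fits in a single window of width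
  \<open>s d\<close>; halving the step leaves room of \<open>s d / 4 \<ge> d / 4\<close> on either side, and then a centre
  within \<open>d / 8\<close> of the midpoint is good enough, as the grid of mesh \<open>d / 4\<close> provides.\<close>

lemma fin_diff_le_sum_open_local_modulus:
  assumes "s \<le> r" and h: "h \<in> {0..d}" and u: "u \<in> {0..d}"
  shows "cmod (fin_diff r h f x)
    \<le> 2 ^ r * (\<Sum>l\<in>{-4..4 * int r}. open_local_modulus s f d (x + u + of_int l * (d / 4)))"
    (is "_ \<le> _ * ?M")
proof -
  have "cmod (fin_diff s (h / 2) f (x + of_nat i * h + of_nat k * (h / 2))) \<le> ?M"
    if "i \<le> r - s" "k \<le> s" for i k
  proof -
    define t where "t = x + of_nat i * h + of_nat k * (h / 2)"
    define z where "z = t + of_nat s * h / 4"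
    define l where "l = round (4 * (z - x - u) / d)"
    define y where "y = x + u + of_int l * (d / 4)"
    \<comment> \<open>\<open>z\<close> is the midpoint of the nodes of the difference and \<open>y\<close> the nearest grid point\<close>
    have "z - x = (of_nat i + of_nat k / 2 + of_nat s / 4) * h"
      by (simp add: z_def t_def algebra_simps)
    moreover have "0 \<le> (of_nat i + of_nat k / 2 + of_nat s / 4 :: real)"
      "(of_nat i + of_nat k / 2 + of_nat s / 4 :: real) \<le> of_nat r"
      using that \<open>s \<le> r\<close> by (auto simp: of_nat_diff)
    ultimately have z: "0 \<le> z - x" "z - x \<le> of_nat r * d"
      using h by (auto intro!: mult_mono)
    have "-4 \<le> 4 * (z - x - u) / d" "4 * (z - x - u) / d \<le> 4 * of_nat r"
      using z u d by (auto simp: field_simps)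
    then have "round (of_int (-4) :: real) \<le> l" "l \<le> round (of_int (4 * int r) :: real)"
      unfolding l_def by (intro round_mono; simp)+
    then have l: "l \<in> {-4..4 * int r}"
      by (simp only: round_of_int atLeastAtMost_iff)
    have "\<bar>of_int l - 4 * (z - x - u) / d\<bar> \<le> 1 / 2"
      unfolding l_def by (rule of_int_round_abs_le)
    then have "\<bar>of_int l - 4 * (z - x - u) / d\<bar> * (d / 4) \<le> 1 / 2 * (d / 4)"
      by (rule mult_right_mono) (use d in simp)
    also have "\<bar>of_int l - 4 * (z - x - u) / d\<bar> * (d / 4) = \<bar>(of_int l - 4 * (z - x - u) / d) * (d / 4)\<bar>"
      using d by (simp add: abs_mult)
    also have "(of_int l - 4 * (z - x - u) / d) * (d / 4) = y - z"
      using d by (simp add: y_def field_simps)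
    finally have yz: "\<bar>y - z\<bar> \<le> d / 8" by simp
    have sh: "0 \<le> of_nat s * h" "of_nat s * h \<le> of_nat s * d" "d \<le> of_nat s * d"
      using h d s by (auto intro!: mult_left_mono)
    have "cmod (fin_diff s (h / 2) f t) \<le> open_local_modulus s f d y"
      by (rule open_local_modulus_upper) (use yz[unfolded z_def] sh d in linarith)+
    also have "\<dots> \<le> ?M"
      unfolding y_def by (rule member_le_sum[OF l]) (auto simp: open_local_modulus_nonneg)
    finally show ?thesis by (simp add: t_def)
  qed
  then have "cmod (fin_diff s (2 * (h / 2)) f (x + of_nat i * h)) \<le> 2 ^ s * ?M" if "i \<le> r - s" for i
    using that by (intro fin_diff_double_step_bound)
  then have "cmod (fin_diff (r - s + s) h f x) \<le> 2 ^ (r - s) * (2 ^ s * ?M)"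
    by (intro fin_diff_raise_order_bound) simp
  with \<open>s \<le> r\<close> show ?thesis by (simp add: mult.assoc[symmetric] power_add[symmetric])
qed

end

section \<open>The modulus of smoothness\<close>

lemma ennreal_power_mono:
  assumes "x \<le> y" and "0 < a"
  shows "ennreal_power x a \<le> ennreal_power y a"
proof (cases "y = \<infinity>")
  case False
  with assms have "x \<noteq> \<infinity>" "enn2real x \<le> enn2real y"
    by (auto simp: top_unique less_top intro!: enn2real_mono)
  with False assms show ?thesis
    by (auto simp: ennreal_power_def intro!: ennreal_leI powr_mono2)
qed (simp add: ennreal_power_def)

lemma ennreal_power_cmult:
  assumes "0 < c" and "0 < a"
  shows "ennreal_power (ennreal c * x) a = ennreal (c powr a) * ennreal_power x a"
proof (cases "x = \<infinity>")
  case True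
  with assms show ?thesis by (simp add: ennreal_power_def ennreal_mult_top)
next
  case False
  with assms show ?thesis
    by (simp add: ennreal_power_def ennreal_mult_eq_top_iff enn2real_mult powr_mult ennreal_mult)
qed

text \<open>The nodes \<open>x, \<dots>, x + s h\<close> lie in the window centred at their midpoint \<open>x + s h / 2\<close>; the
  translation by \<open>s h / 2\<close> does not change the norm.  It is applied to the difference, which is
  measurable, and not to the local modulus.\<close>

lemma smoothness_modulus_le_averaged_modulus:
  assumes f: "f \<in> bounded_measurable" and "0 < p"
  shows "smoothness_modulus s p f d \<le> averaged_modulus s p f d"
  unfolding smoothness_modulus_def
proof (rule SUP_least)
  fix h assume h: "h \<in> {0<..d}"
  from f obtain B where meas: "f \<in> borel_measurable lebesgue" and B: "\<And>y. cmod (f y) \<le> B"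
    by (auto simp: bounded_measurable_def bounded_iff)
  have "(\<lambda>x. f (x + c)) \<in> borel_measurable lebesgue" for c
    by (rule measurable_compose[OF measurable_lebesgue_translation meas])
  then have "fin_diff s h f \<in> borel_measurable lebesgue"
    unfolding fin_diff_def[abs_def]
    by (intro borel_measurable_sum borel_measurable_times borel_measurable_const)
  then have "(\<lambda>x. ennreal (cmod (fin_diff s h f x) powr p)) \<in> borel_measurable lebesgue"
    by measurable
  then have "(\<integral>\<^sup>+x. ennreal (cmod (fin_diff s h f x) powr p) \<partial>lebesgue)
    = (\<integral>\<^sup>+x. ennreal (cmod (fin_diff s h f (x + - of_nat s * h / 2)) powr p) \<partial>lebesgue)"
    by (rule nn_integral_lebesgue_translation[symmetric])
  also have "\<dots> \<le> (\<integral>\<^sup>+x. ennreal (norm (local_modulus s f x d) powr p) \<partial>lebesgue)"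
  proof (intro nn_integral_mono ennreal_leI powr_mono2)
    fix x
    have "0 \<le> of_nat s * h" "of_nat s * h \<le> of_nat s * d"
      using h by (auto intro!: mult_left_mono)
    then have "\<bar>x + - of_nat s * h / 2 - x\<bar> \<le> of_nat s * d / 2"
      "\<bar>x + - of_nat s * h / 2 + of_nat s * h - x\<bar> \<le> of_nat s * d / 2"
      by linarith+
    from local_modulus_upper[of f B, OF B this]
    show "cmod (fin_diff s h f (x + - of_nat s * h / 2)) \<le> norm (local_modulus s f x d)"
      by simp
  qed (use \<open>0 < p\<close> in auto)
  finally show "Lp_norm p (fin_diff s h f) \<le> averaged_modulus s p f d"
    unfolding averaged_modulus_def Lp_norm_def
    by (rule ennreal_power_mono) (use \<open>0 < p\<close> in simp)
qed

section \<open>Norms on the nodes\<close>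

text \<open>A sum is at most the number of its terms times the largest one.\<close>

lemma powr_sum_le:
  fixes a :: "'i \<Rightarrow> real"
  assumes "finite L" and nn: "\<And>l. l \<in> L \<Longrightarrow> 0 \<le> a l" and "0 < p"
  shows "(\<Sum>l\<in>L. a l) powr p \<le> of_nat (card L) powr p * (\<Sum>l\<in>L. a l powr p)"
proof (cases "L = {}")
  case False
  define m where "m = Max (a ` L)"
  have "m \<in> a ` L" unfolding m_def using False \<open>finite L\<close> by (intro Max_in) auto
  then obtain l\<^sub>0 where l\<^sub>0: "l\<^sub>0 \<in> L" "m = a l\<^sub>0" by auto
  have "(\<Sum>l\<in>L. a l) \<le> of_nat (card L) * m"
    by (rule sum_bounded_above) (simp add: m_def \<open>finite L\<close>)
  then have "(\<Sum>l\<in>L. a l) powr p \<le> (of_nat (card L) * m) powr p"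
    using nn \<open>0 < p\<close> by (intro powr_mono2 sum_nonneg) auto
  also have "\<dots> = of_nat (card L) powr p * a l\<^sub>0 powr p"
    using nn l\<^sub>0 by (simp add: powr_mult)
  also have "\<dots> \<le> of_nat (card L) powr p * (\<Sum>l\<in>L. a l powr p)"
    using l\<^sub>0 \<open>finite L\<close> by (intro mult_left_mono member_le_sum) auto
  finally show ?thesis .
qed simp

text \<open>The passage from samples to an integral.  The value at the node \<open>j d\<close> is dominated for every
  shift \<open>u\<close>, that is, with \<open>v = j d + u\<close>, by a function of \<open>v\<close> on the whole interval
  \<open>[j d, (j + 1) d)\<close>.  Integrating over this interval produces the weight \<open>d\<close> of the node, and
  adding up the disjoint intervals produces integrals over the line, which do not see the
  offsets \<open>c l\<close>.\<close>

lemma sampled_power_sum_le: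
  fixes \<omega> :: "real \<Rightarrow> real" and c :: "'i \<Rightarrow> real"
  assumes [measurable]: "\<omega> \<in> borel_measurable borel" and nn: "\<And>x. 0 \<le> \<omega> x"
    and "finite L" "0 < d" "0 < p" "0 \<le> A"
    and dom: "\<And>x u. u \<in> {0..d} \<Longrightarrow> cmod (g x) \<le> A * (\<Sum>l\<in>L. \<omega> (x + u + c l))"
  shows "(\<Sum>\<^sub>\<infinity>j::int. ennreal (cmod (g (of_int j * d)) powr p * d))
    \<le> ennreal ((A * of_nat (card L)) powr p * of_nat (card L)) * (\<integral>\<^sup>+x. ennreal (\<omega> x powr p) \<partial>lborel)"
proof -
  define P where "P x = ennreal (\<omega> x powr p)" for x
  define K where "K = (A * of_nat (card L)) powr p"
  define I where "I j = {of_int j * d..<of_int (j + 1) * d}" for j :: int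
  have [measurable]: "P \<in> borel_measurable borel" unfolding P_def[abs_def] by measurable
  have pointwise: "ennreal (cmod (g (of_int j * d)) powr p) \<le> ennreal K * (\<Sum>l\<in>L. P (v + c l))"
    if v: "v \<in> I j" for j v
  proof -
    have "cmod (g (of_int j * d)) \<le> A * (\<Sum>l\<in>L. \<omega> (v + c l))"
      using dom[of "v - of_int j * d" "of_int j * d"] v by (simp add: I_def algebra_simps)
    then have "cmod (g (of_int j * d)) powr p \<le> (A * (\<Sum>l\<in>L. \<omega> (v + c l))) powr p"
      using \<open>0 < p\<close> by (intro powr_mono2) auto
    also have "\<dots> = A powr p * (\<Sum>l\<in>L. \<omega> (v + c l)) powr p"
      by (rule powr_mult)
    also have "\<dots> \<le> A powr p * (of_nat (card L) powr p * (\<Sum>l\<in>L. \<omega> (v + c l) powr p))"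
      using \<open>finite L\<close> nn \<open>0 < p\<close> by (intro mult_left_mono powr_sum_le) auto
    also have "\<dots> = K * (\<Sum>l\<in>L. \<omega> (v + c l) powr p)"
      using \<open>0 \<le> A\<close> by (simp add: K_def powr_mult)
    finally show ?thesis
      by (simp add: P_def sum_nonneg K_def ennreal_leI flip: ennreal_mult)
  qed
  have transl: "(\<integral>\<^sup>+v. P (v + c l) \<partial>lborel) = (\<integral>\<^sup>+v. P v \<partial>lborel)" for l
    using nn_integral_lebesgue_translation[of P "c l"] by (simp add: nn_integral_completion measurable_completion)
  have disj: "disjoint_family I"
  proof -
    have "j = k" if "v \<in> I j" "v \<in> I k" for j k v
    proof -
      have "of_int j * d < of_int (k + 1) * d" "of_int k * d < of_int (j + 1) * d"
        using that unfolding I_def atLeastLessThan_iff by linarith+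
      then have "j < k + 1" "k < j + 1"
        using \<open>0 < d\<close> by (simp_all only: mult_less_cancel_right_pos of_int_less_iff)
      then show ?thesis by simp
    qed
    then show ?thesis by (auto simp: disjoint_family_on_def)
  qed
  have fin: "(\<Sum>j\<in>F. ennreal (cmod (g (of_int j * d)) powr p * d))
      \<le> ennreal (K * of_nat (card L)) * (\<integral>\<^sup>+x. P x \<partial>lborel)" if "finite F" for F
  proof -
    have I[measurable]: "I j \<in> sets borel" for j by (simp add: I_def)
    have "emeasure lborel (I j) = ennreal d" for j
      using \<open>0 < d\<close> by (simp add: I_def algebra_simps)
    then have "(\<Sum>j\<in>F. ennreal (cmod (g (of_int j * d)) powr p * d))
      = (\<Sum>j\<in>F. \<integral>\<^sup>+v. ennreal (cmod (g (of_int j * d)) powr p) * indicator (I j) v \<partial>lborel)"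
      using \<open>0 < d\<close> by (simp add: nn_integral_cmult_indicator ennreal_mult I)
    also have "\<dots> \<le> (\<Sum>j\<in>F. \<integral>\<^sup>+v. (ennreal K * (\<Sum>l\<in>L. P (v + c l))) * indicator (I j) v \<partial>lborel)"
      using pointwise by (intro sum_mono nn_integral_mono) (auto split: split_indicator)
    also have "\<dots> = (\<integral>\<^sup>+v. (\<Sum>j\<in>F. (ennreal K * (\<Sum>l\<in>L. P (v + c l))) * indicator (I j) v) \<partial>lborel)"
      by (rule nn_integral_sum[symmetric]) measurable
    also have "\<dots> = (\<integral>\<^sup>+v. (ennreal K * (\<Sum>l\<in>L. P (v + c l))) * indicator (\<Union>j\<in>F. I j) v \<partial>lborel)"
      using \<open>finite F\<close> disj
      by (simp add: indicator_UN_disjoint disjoint_family_on_def sum_distrib_left)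
    also have "\<dots> \<le> (\<integral>\<^sup>+v. ennreal K * (\<Sum>l\<in>L. P (v + c l)) \<partial>lborel)"
      by (intro nn_integral_mono) (auto split: split_indicator)
    also have "\<dots> = ennreal K * (of_nat (card L) * (\<integral>\<^sup>+x. P x \<partial>lborel))"
      by (simp add: nn_integral_cmult nn_integral_sum transl)
    finally show ?thesis
      by (simp add: K_def ennreal_mult ennreal_of_nat_eq_real_of_nat mult.assoc)
  qed
  have "(\<Sum>\<^sub>\<infinity>j::int. ennreal (cmod (g (of_int j * d)) powr p * d))
      \<le> ennreal (K * of_nat (card L)) * (\<integral>\<^sup>+x. P x \<partial>lborel)"
    by (subst nonneg_infsum_complete) (auto intro!: SUP_least fin)
  then show ?thesis by (simp add: K_def P_def)
qed

theorem theorem4p4: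
  fixes r s :: nat and p :: real
  assumes "1 \<le> r" and "1 \<le> s" and "s \<le> r" and "1 \<le> p"
  shows "\<exists>C::real. C > 0 \<and>
           (\<forall>f \<in> Lambda_space p. \<forall>W::real. W > 0 \<longrightarrow>
              semi_discrete_modulus r s p f (1 / W) (uniform_nodes W)
                \<le> ennreal C * averaged_modulus s p f (1 / W))"
proof -
  define L where "L = {-4..4 * int r}"
  define K where "K = (2 ^ r * of_nat (card L)) powr p * of_nat (card L)"
  have "L \<noteq> {}" "finite L" by (auto simp: L_def)
  then have "0 < card L" by (simp add: card_gt_0_iff)
  then have "0 < K" by (simp add: K_def)
  have "0 < 1 / p" "0 < p" using \<open>1 \<le> p\<close> by auto
  have "semi_discrete_modulus r s p f d (uniform_nodes W)
      \<le> ennreal (K powr (1 / p) + 1) * averaged_modulus s p f d"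
    if "f \<in> Lambda_space p" "0 < W" and d_def: "d = 1 / W" for f W d
  proof -
    have "0 < d" using that by simp
    from that have f: "f \<in> bounded_measurable" by (simp add: Lambda_space_def)
    then obtain B where meas: "f \<in> borel_measurable lebesgue" and B: "\<And>y. cmod (f y) \<le> B"
      by (auto simp: bounded_measurable_def bounded_iff)
    note olm = B \<open>0 < d\<close> \<open>1 \<le> s\<close>
    define g where "g x = steklov d r f x - f x" for x
    have "cmod (g x) \<le> 2 ^ r * (\<Sum>l\<in>L. open_local_modulus s f d (x + u + of_int l * (d / 4)))"
      if "u \<in> {0..d}" for x u
      unfolding g_def L_def
      by (intro steklov_minus_bound[OF meas B] fin_diff_le_sum_open_local_modulus[of f B, OF olm])
         (use assms that \<open>0 < d\<close> in auto)
    from sampled_power_sum_le[where g = g and p = p and d = d and L = L and A = "2 ^ r"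
        and c = "\<lambda>l. of_int l * (d / 4)" and \<omega> = "open_local_modulus s f d", OF _ _ _ _ _ _ this]
    have "(\<Sum>\<^sub>\<infinity>j::int. ennreal (cmod (g (of_int j * d)) powr p * d))
      \<le> ennreal K * (\<integral>\<^sup>+x. ennreal (open_local_modulus s f d x powr p) \<partial>lborel)"
      using \<open>finite L\<close> \<open>0 < d\<close> \<open>0 < p\<close> open_local_modulus_measurable[of f B, OF olm]
        open_local_modulus_nonneg[of f B, OF olm] by (simp add: K_def)
    also have "(\<Sum>\<^sub>\<infinity>j::int. ennreal (cmod (g (of_int j * d)) powr p * d))
      = (\<Sum>\<^sub>\<infinity>j. ennreal (cmod (g (uniform_nodes W j)) powr p * (uniform_nodes W j - uniform_nodes W (j - 1))))"
      by (simp add: uniform_nodes_def d_def diff_divide_distrib)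
    also have "(\<integral>\<^sup>+x. ennreal (open_local_modulus s f d x powr p) \<partial>lborel)
      \<le> (\<integral>\<^sup>+x. ennreal (norm (local_modulus s f x d) powr p) \<partial>lborel)"
      using \<open>0 < p\<close> open_local_modulus_nonneg[of f B, OF olm] open_local_modulus_le[of f B, OF olm]
      by (intro nn_integral_mono ennreal_leI powr_mono2) (auto intro: order_trans[OF _ abs_ge_self])
    finally have "(\<Sum>\<^sub>\<infinity>j. ennreal (cmod (g (uniform_nodes W j)) powr p * (uniform_nodes W j - uniform_nodes W (j - 1))))
      \<le> ennreal K * (\<integral>\<^sup>+x. ennreal (norm (local_modulus s f x d) powr p) \<partial>lborel)"
      by (simp add: mult_left_mono)
    from ennreal_power_mono[OF this \<open>0 < 1 / p\<close>]
    have "lp_norm p (uniform_nodes W) g \<le> ennreal (K powr (1 / p)) * averaged_modulus s p f d"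
      using \<open>0 < K\<close> \<open>0 < 1 / p\<close>
      by (simp add: lp_norm_def averaged_modulus_def Lp_norm_def ennreal_power_cmult nn_integral_completion)
    with smoothness_modulus_le_averaged_modulus[OF f \<open>0 < p\<close>, of s d] show ?thesis
      by (simp add: semi_discrete_modulus_def g_def[abs_def] ennreal_plus distrib_right add_mono)
  qed
  then show ?thesis
    by (intro exI[of _ "K powr (1 / p) + 1"]) (auto intro: add_nonneg_pos)
qed

end
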